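(* Let $(\Lambda, d)$ be a finitely aligned (discrete) $k$-graph with no sources, let $X$ be a second countable, locally compact, Hausdorff space, and let $$\tau:\Lambda \rightarrow \{\phi:X \rightarrow X \mid \phi \text{ is a local homeomorphism}\}, \qquad \lambda\mapsto\tau_\lambda,$$ be a continuous functor. Define $\Lambda\times_\tau X$ to have object and morphism sets $$\mathrm{Obj}(\Lambda \times_\tau X) := \mathrm{Obj}(\Lambda) \times X \quad\text{and}\quad \mathrm{Mor}(\Lambda \times_\tau X) := \mathrm{Mor}(\Lambda) \times X,$$ range and source maps $$r(\lambda, x) := (r(\lambda), \tau_\lambda(x)) \quad\text{and}\quad s(\lambda, x) := (s(\lambda), x),$$ composition $$(\lambda, \tau_\mu(x))\circ(\mu, x) = (\lambda\mu , x)\quad\text{whenever } s(\lambda) = r(\mu) \text{ in } (\Lambda,d),$$ and degree functor $$\tilde{d}(\lambda,x) = d(\lambda).$$ Then the pair $(\Lambda \times_\tau X, \tilde{d})$ is a topological $k$-graph.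
   Context: $\mathbb{N}$ contains $0$; $\mathbb{N}^k$ is regarded as a category with one object and composition given by addition. A topological $k$-graph is a pair $(\Gamma,d)$ consisting of a small category $\Gamma = (\mathrm{Obj}(\Gamma),\mathrm{Mor}(\Gamma), r,s)$ and a functor $d:\Gamma\to\mathbb{N}^k$ such that: (1) $\mathrm{Obj}(\Gamma)$ and $\mathrm{Mor}(\Gamma)$ are second-countable, locally compact, Hausdorff spaces; (2) the range and source maps $r,s:\mathrm{Mor}(\Gamma)\to\mathrm{Obj}(\Gamma)$ are continuous and $s$ is a local homeomorphism; (3) composition $\circ:\Gamma\times_c\Gamma\to\Gamma$ is continuous and open, where $\Gamma\times_c\Gamma$ is the set of composable pairs $(\lambda,\mu)$, $s(\lambda)=r(\mu)$, with the relative topology from the product topology; (4) $d$ is continuous, where $\mathbb{N}^k$ is discrete; (5) (unique factorization) for all $\lambda\in\Gamma$ and $m,n\in\mathbb{N}^k$ with $d(\lambda)=m+n$ there exist unique $\mu,\nu\in\Gamma$ with $d(\mu)=m$, $d(\nu)=n$ and $\lambda=\mu\nu$. A (discrete) $k$-graph $(\Lambda,d)$ is a countable small category with a functor $d:\Lambda\to\mathbb{N}^k$ satisfying (5); equivalently a topological $k$-graph whose object and morphism spaces are discrete. It is finitely aligned if for all $\mu,\nu\in\Lambda$ the set of minimal common extensions $\{\lambda : \lambda=\mu\mu'=\nu\nu' \text{ for some } \mu',\nu'\in\Lambda,\ d(\lambda)=d(\mu)\vee d(\nu)\}$ is finite, where $\vee$ is the coordinatewise maximum. It has no sources if for every object $v$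 and every $n\in\mathbb{N}^k$ there is $\lambda$ with $r(\lambda)=v$ and $d(\lambda)=n$. The set of local homeomorphisms $X\to X$ is regarded as a category with one object under composition of maps, so that $\tau$ being a functor means $\tau_{\lambda\mu}=\tau_\lambda\circ\tau_\mu$ whenever $s(\lambda)=r(\mu)$ and $\tau_v=\mathrm{id}_X$ for identity morphisms $v$. Since $\Lambda$ carries the discrete topology, continuity of $\tau$ is automatic. $\mathrm{Obj}(\Lambda)\times X$ and $\mathrm{Mor}(\Lambda)\times X$ carry the product topologies. *)

theory Defs
  imports "HOL-Analysis.Analysis" "HOL-Library.Function_Algebras"
begin

section \<open>Small categories\<close>

record ('o, 'm) cat =
  Obj :: "'o set"
  Mor :: "'m set"
  rng :: "'m \<Rightarrow> 'o"
  src :: "'m \<Rightarrow> 'o"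
  idn :: "'o \<Rightarrow> 'm"
  cmp :: "'m \<Rightarrow> 'm \<Rightarrow> 'm"

text \<open>\<open>cmp C l m\<close> is the composite \<open>l m\<close> and is meaningful only when \<open>src C l = rng C m\<close>.\<close>

definition composable :: "('o, 'm) cat \<Rightarrow> ('m \<times> 'm) set" where
  "composable C = {(l, m). l \<in> Mor C \<and> m \<in> Mor C \<and> src C l = rng C m}"

locale small_category =
  fixes C :: "('o, 'm) cat"
  assumes rng_obj: "\<And>l. l \<in> Mor C \<Longrightarrow> rng C l \<in> Obj C"
    and src_obj: "\<And>l. l \<in> Mor C \<Longrightarrow> src C l \<in> Obj C"
    and idn_mor: "\<And>v. v \<in> Obj C \<Longrightarrow> idn C v \<in> Mor C"
    and rng_idn: "\<And>v. v \<in> Obj C \<Longrightarrow> rng C (idn C v) = v"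
    and src_idn: "\<And>v. v \<in> Obj C \<Longrightarrow> src C (idn C v) = v"
    and cmp_mor: "\<And>l m. (l, m) \<in> composable C \<Longrightarrow> cmp C l m \<in> Mor C"
    and rng_cmp: "\<And>l m. (l, m) \<in> composable C \<Longrightarrow> rng C (cmp C l m) = rng C l"
    and src_cmp: "\<And>l m. (l, m) \<in> composable C \<Longrightarrow> src C (cmp C l m) = src C m"
    and idn_cmp: "\<And>l. l \<in> Mor C \<Longrightarrow> cmp C (idn C (rng C l)) l = l"
    and cmp_idn: "\<And>l. l \<in> Mor C \<Longrightarrow> cmp C l (idn C (src C l)) = l"
    and cmp_assoc: "\<And>l m n. (l, m) \<in> composable C \<Longrightarrow> (m, n) \<in> composable C \<Longrightarrow>
                      cmp C (cmp C l m) n = cmp C l (cmp C m n)"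

section \<open>Degree functors\<close>

text \<open>
  \<open>Nvec k\<close> is the monoid of \<open>k\<close>-tuples of naturals, for any \<open>k \<ge> 0\<close>, encoded as the functions on
  \<open>nat\<close> that vanish from \<open>k\<close> on. Addition, zero and the coordinatewise maximum \<open>sup\<close> are the
  pointwise operations on functions, under which \<open>Nvec k\<close> is closed.
\<close>

definition Nvec :: "nat \<Rightarrow> (nat \<Rightarrow> nat) set" where
  "Nvec k = {n. \<forall>i\<ge>k. n i = 0}"

definition degree_functor ::
  "nat \<Rightarrow> ('o, 'm) cat \<Rightarrow> ('m \<Rightarrow> nat \<Rightarrow> nat) \<Rightarrow> bool" where
  "degree_functor k C d \<longleftrightarrow>
     d \<in> Mor C \<rightarrow> Nvec k \<and>
     (\<forall>v\<in>Obj C. d (idn C v) = 0) \<and>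
     (\<forall>(l, m)\<in>composable C. d (cmp C l m) = d l + d m)"

definition unique_factorization ::
  "nat \<Rightarrow> ('o, 'm) cat \<Rightarrow> ('m \<Rightarrow> nat \<Rightarrow> nat) \<Rightarrow> bool" where
  "unique_factorization k C d \<longleftrightarrow>
     (\<forall>l\<in>Mor C. \<forall>m\<in>Nvec k. \<forall>n\<in>Nvec k. d l = m + n \<longrightarrow>
        (\<exists>!(\<mu>, \<nu>). (\<mu>, \<nu>) \<in> composable C \<and> d \<mu> = m \<and> d \<nu> = n \<and> l = cmp C \<mu> \<nu>))"

section \<open>Discrete k-graphs\<close>

locale k_graph = small_category C
  for k :: nat and C :: "('o, 'm) cat" and d :: "'m \<Rightarrow> nat \<Rightarrow> nat" +
  assumes countable_obj: "countable (Obj C)"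
    and countable_mor: "countable (Mor C)"
    and degree: "degree_functor k C d"
    and factorization: "unique_factorization k C d"

definition min_common_ext ::
  "('o, 'm) cat \<Rightarrow> ('m \<Rightarrow> nat \<Rightarrow> nat) \<Rightarrow> 'm \<Rightarrow> 'm \<Rightarrow> 'm set" where
  "min_common_ext C d \<mu> \<nu> =
     {l. (\<exists>\<mu>' \<nu>'. (\<mu>, \<mu>') \<in> composable C \<and> (\<nu>, \<nu>') \<in> composable C \<and>
            l = cmp C \<mu> \<mu>' \<and> l = cmp C \<nu> \<nu>') \<and>
         d l = sup (d \<mu>) (d \<nu>)}"

definition finitely_aligned :: "('o, 'm) cat \<Rightarrow> ('m \<Rightarrow> nat \<Rightarrow> nat) \<Rightarrow> bool" where
  "finitely_aligned C d \<longleftrightarrow>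
     (\<forall>\<mu>\<in>Mor C. \<forall>\<nu>\<in>Mor C. finite (min_common_ext C d \<mu> \<nu>))"

definition no_sources :: "nat \<Rightarrow> ('o, 'm) cat \<Rightarrow> ('m \<Rightarrow> nat \<Rightarrow> nat) \<Rightarrow> bool" where
  "no_sources k C d \<longleftrightarrow>
     (\<forall>v\<in>Obj C. \<forall>n\<in>Nvec k. \<exists>l\<in>Mor C. rng C l = v \<and> d l = n)"

section \<open>Topological k-graphs\<close>

definition local_homeo :: "'a topology \<Rightarrow> 'b topology \<Rightarrow> ('a \<Rightarrow> 'b) \<Rightarrow> bool" where
  "local_homeo X Y f \<longleftrightarrow>
     f \<in> topspace X \<rightarrow> topspace Y \<and>
     (\<forall>x\<in>topspace X. \<exists>U. openin X U \<and> x \<in> U \<and> openin Y (f ` U) \<and>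
        homeomorphic_map (subtopology X U) (subtopology Y (f ` U)) f)"

text \<open>The topologies of the object and morphism spaces are \<open>TO\<close> and \<open>TM\<close>.\<close>

locale topological_k_graph = small_category C
  for k :: nat and C :: "('o, 'm) cat" and TO :: "'o topology" and TM :: "'m topology"
    and d :: "'m \<Rightarrow> nat \<Rightarrow> nat" +
  assumes topspace_obj: "topspace TO = Obj C"
    and topspace_mor: "topspace TM = Mor C"
    and degree: "degree_functor k C d"
    and obj_space: "second_countable TO" "locally_compact_space TO" "Hausdorff_space TO"
    and mor_space: "second_countable TM" "locally_compact_space TM" "Hausdorff_space TM"
    and rng_continuous: "continuous_map TM TO (rng C)"
    and src_continuous: "continuous_map TM TO (src C)"
    and src_local_homeo: "local_homeo TM TO (src C)"
    and cmp_continuous: "continuous_map (subtopology (prod_topology TM TM) (composable C)) TM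
                           (\<lambda>(l, m). cmp C l m)"
    and cmp_open: "open_map (subtopology (prod_topology TM TM) (composable C)) TM
                     (\<lambda>(l, m). cmp C l m)"
    and degree_continuous: "continuous_map TM (discrete_topology (Nvec k)) d"
    and factorization: "unique_factorization k C d"

section \<open>The skew product by a functor into local homeomorphisms\<close>

text \<open>Maps \<open>X \<rightarrow> X\<close> are compared on \<open>topspace X\<close> only.\<close>

definition local_homeo_functor ::
  "('o, 'm) cat \<Rightarrow> 'x topology \<Rightarrow> ('m \<Rightarrow> 'x \<Rightarrow> 'x) \<Rightarrow> bool" where
  "local_homeo_functor C X \<tau> \<longleftrightarrow>
     (\<forall>l\<in>Mor C. local_homeo X X (\<tau> l)) \<and>
     (\<forall>v\<in>Obj C. \<forall>x\<in>topspace X. \<tau> (idn C v) x = x) \<and>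
     (\<forall>(l, m)\<in>composable C. \<forall>x\<in>topspace X. \<tau> (cmp C l m) x = \<tau> l (\<tau> m x))"

text \<open>
  Morphisms \<open>(l, y)\<close> and \<open>(m, x)\<close> are composable here iff \<open>src C l = rng C m\<close> and \<open>y = \<tau> m x\<close>;
  the second component of the left factor is therefore redundant in the composite. The identity
  at \<open>(v, x)\<close> is forced to be \<open>(idn C v, x)\<close>.
\<close>

definition skew_product ::
  "('o, 'm) cat \<Rightarrow> 'x topology \<Rightarrow> ('m \<Rightarrow> 'x \<Rightarrow> 'x) \<Rightarrow> ('o \<times> 'x, 'm \<times> 'x) cat" where
  "skew_product C X \<tau> =
     \<lparr> Obj = Obj C \<times> topspace X,
       Mor = Mor C \<times> topspace X,
       rng = (\<lambda>(l, x). (rng C l, \<tau> l x)),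
       src = (\<lambda>(l, x). (src C l, x)),
       idn = (\<lambda>(v, x). (idn C v, x)),
       cmp = (\<lambda>(l, y) (m, x). (cmp C l m, x)) \<rparr>"

definition skew_degree :: "('m \<Rightarrow> nat \<Rightarrow> nat) \<Rightarrow> 'm \<times> 'x \<Rightarrow> nat \<Rightarrow> nat" where
  "skew_degree d = (\<lambda>(l, x). d l)"

end

theory Submission
  imports Defs
begin

text \<open>
  The algebraic half of the claim is bookkeeping. A composable pair of the skew product has the form
  \<open>((l, \<tau> m x), (m, x))\<close> with \<open>(l, m)\<close> composable in \<open>\<Lambda>\<close>, so it is a composable pair of \<open>\<Lambda>\<close>
  together with a point \<open>x\<close> (\<open>mem_composable_skew_product\<close>); functoriality of \<open>\<tau>\<close> makes the range
  of a composite come out right. In a factorization of \<open>(l, x)\<close> the right factor must be \<open>(\<nu>, x)\<close>,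
  and composability then forces the left one to be \<open>(\<mu>, \<tau> \<nu> x)\<close>, so factorizations of \<open>(l, x)\<close>
  correspond to factorizations of \<open>l\<close>.

  The topological half rests on the fact that a product \<open>D \<times> X\<close> with \<open>D\<close> discrete is a disjoint
  union of open copies \<open>{a} \<times> X\<close> of \<open>X\<close>, so that continuity out of it
  (\<open>continuous_map_prod_discrete\<close>) can be checked one copy at a time. On the copy over \<open>l\<close> the range
  map is \<open>\<tau> l\<close>, and the source map is a homeomorphism onto the copy over \<open>src l\<close>. Composition is
  open because \<open>((l, \<tau> m x), (m, x))\<close> depends continuously on \<open>x\<close>: moving \<open>x\<close> slightly, with \<open>l\<close>
  and \<open>m\<close> fixed, stays inside a given open set of composable pairs, and the composites
  \<open>(l m, x)\<close> so obtained fill out a neighbourhood in the copy over \<open>l m\<close>.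
\<close>

section \<open>Products with a discrete factor\<close>

lemma continuous_map_Pair_discrete:
  assumes "a \<in> D" "continuous_map X Y g"
  shows "continuous_map X (prod_topology (discrete_topology D) Y) (\<lambda>x. (a, g x))"
  using assms by (simp add: continuous_map_pairwise comp_def)

lemma continuous_map_prod_discrete:
  assumes slices: "\<And>a. a \<in> D \<Longrightarrow> continuous_map X Y (\<lambda>x. f (a, x))"
  shows "continuous_map (prod_topology (discrete_topology D) X) Y f"
proof -
  have "openin (prod_topology (discrete_topology D) X)
          {p \<in> topspace (prod_topology (discrete_topology D) X). f p \<in> V}" (is "openin ?T ?S")
    if V: "openin Y V" for V
  proof -
    have "?S = (\<Union>a\<in>D. {a} \<times> {x \<in> topspace X. f (a, x) \<in> V})" by auto
    moreover have "openin ?T ({a} \<times> {x \<in> topspace X. f (a, x) \<in> V})" if "a \<in> D" for a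
      using that openin_continuous_map_preimage[OF slices[OF that] V]
      by (simp add: openin_prod_Times_iff)
    ultimately show ?thesis by (auto intro!: openin_clauses(3))
  qed
  moreover have "f p \<in> topspace Y" if "p \<in> topspace (prod_topology (discrete_topology D) X)" for p
    using that slices by (cases p) (force simp: continuous_map_def)
  ultimately show ?thesis by (auto simp: continuous_map_def)
qed

lemma second_countable_prod_topology:
  assumes "second_countable X" "second_countable Y"
  shows "second_countable (prod_topology X Y)"
proof -
  obtain B C where B: "countable B" "\<And>V. V \<in> B \<Longrightarrow> openin X V"
      "\<And>U x. openin X U \<Longrightarrow> x \<in> U \<Longrightarrow> \<exists>V\<in>B. x \<in> V \<and> V \<subseteq> U"
    and C: "countable C" "\<And>V. V \<in> C \<Longrightarrow> openin Y V"
      "\<And>U x. openin Y U \<Longrightarrow> x \<in> U \<Longrightarrow> \<exists>V\<in>C. x \<in> V \<and> V \<subseteq> U"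
    using assms unfolding second_countable_def by metis
  let ?P = "(\<lambda>(V, W). V \<times> W) ` (B \<times> C)"
  have "\<exists>P\<in>?P. z \<in> P \<and> P \<subseteq> U" if U: "openin (prod_topology X Y) U" "z \<in> U" for U z
  proof -
    obtain x y where z: "z = (x, y)" by (cases z)
    obtain V W where VW: "openin X V" "openin Y W" "x \<in> V" "y \<in> W" "V \<times> W \<subseteq> U"
      using openin_prod_topology_alt[THEN iffD1, OF U(1), rule_format, of x y] U(2)
      unfolding z by blast
    obtain V' W' where "V' \<in> B" "x \<in> V'" "V' \<subseteq> V" "W' \<in> C" "y \<in> W'" "W' \<subseteq> W"
      using B(3)[OF VW(1,3)] C(3)[OF VW(2,4)] by blast
    with VW(5) show ?thesis unfolding z by (intro bexI[of _ "V' \<times> W'"]) auto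
  qed
  moreover have "\<forall>P\<in>?P. openin (prod_topology X Y) P"
    using B(2) C(2) by (auto simp: openin_prod_Times_iff)
  moreover have "countable ?P" using B(1) C(1) by simp
  ultimately show ?thesis unfolding second_countable_def by metis
qed

section \<open>Local homeomorphisms\<close>

text \<open>Continuity is a local property, and a local homeomorphism is continuous near each point.\<close>

lemma local_homeo_imp_continuous_map:
  assumes "local_homeo X Y f"
  shows "continuous_map X Y f"
proof -
  have "openin X {x \<in> topspace X. f x \<in> V}" if V: "openin Y V" for V
  proof (subst openin_subopen, intro ballI)
    fix x assume x: "x \<in> {x \<in> topspace X. f x \<in> V}"
    then obtain U where U: "openin X U" "x \<in> U"
        "homeomorphic_map (subtopology X U) (subtopology Y (f ` U)) f"
      using assms unfolding local_homeo_def by blast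
    have "continuous_map (subtopology X U) Y f"
      using U(3) continuous_map_in_subtopology homeomorphic_imp_continuous_map by blast
    from openin_continuous_map_preimage[OF this V]
    have "openin X {z \<in> topspace (subtopology X U). f z \<in> V}"
      using U(1) openin_trans_full by blast
    then show "\<exists>T. openin X T \<and> x \<in> T \<and> T \<subseteq> {x \<in> topspace X. f x \<in> V}"
      using x U(2) by (intro exI[of _ "{z \<in> topspace (subtopology X U). f z \<in> V}"]) auto
  qed
  with assms show ?thesis by (auto simp: continuous_map_def local_homeo_def)
qed

text \<open>A map that acts on the discrete coordinate alone carries the copy of \<open>X\<close> over \<open>a\<close>
  identically onto the copy over \<open>f a\<close>; \<open>f\<close> itself may be arbitrarily far from injective.\<close>

lemma local_homeo_prod_discrete:
  assumes f: "f \<in> D \<rightarrow> E"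
  shows "local_homeo (prod_topology (discrete_topology D) X)
           (prod_topology (discrete_topology E) X) (\<lambda>(a, x). (f a, x))"
    (is "local_homeo ?S ?T ?F")
  unfolding local_homeo_def
proof (intro conjI ballI)
  show "?F \<in> topspace ?S \<rightarrow> topspace ?T" using f by auto
  fix p assume "p \<in> topspace ?S"
  then obtain a x where p: "p = (a, x)" "a \<in> D" "x \<in> topspace X" by auto
  let ?U = "{a} \<times> topspace X"
  have FU: "?F ` ?U = {f a} \<times> topspace X" by force
  have fa: "f a \<in> E" using f p by auto
  have "continuous_map ?S ?T ?F"
    using f by (intro continuous_map_prod_discrete) (auto intro!: continuous_map_Pair_discrete)
  moreover have "continuous_map ?T ?S (\<lambda>(b, y). (a, y))"
    using p(2) by (intro continuous_map_prod_discrete) (auto intro!: continuous_map_Pair_discrete)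
  ultimately have "homeomorphic_maps (subtopology ?S ?U) (subtopology ?T (?F ` ?U)) ?F
      (\<lambda>(b, y). (a, y))"
    unfolding FU homeomorphic_maps_def
    by (auto simp: continuous_map_in_subtopology intro: continuous_map_from_subtopology)
  then have "homeomorphic_map (subtopology ?S ?U) (subtopology ?T (?F ` ?U)) ?F"
    using homeomorphic_map_maps by blast
  moreover have "openin ?S ?U" "openin ?T (?F ` ?U)"
    unfolding FU using p(2) fa by (simp_all add: openin_prod_Times_iff)
  ultimately show "\<exists>U. openin ?S U \<and> p \<in> U \<and> openin ?T (?F ` U) \<and>
      homeomorphic_map (subtopology ?S U) (subtopology ?T (?F ` U)) ?F"
    using p by (intro exI[of _ ?U]) auto
qed

section \<open>The skew product as a category\<close>

lemma skew_product_simps [simp]: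
  "Obj (skew_product C X \<tau>) = Obj C \<times> topspace X"
  "Mor (skew_product C X \<tau>) = Mor C \<times> topspace X"
  "rng (skew_product C X \<tau>) (l, x) = (rng C l, \<tau> l x)"
  "src (skew_product C X \<tau>) (l, x) = (src C l, x)"
  "idn (skew_product C X \<tau>) (v, x) = (idn C v, x)"
  "cmp (skew_product C X \<tau>) (l, y) (m, x) = (cmp C l m, x)"
  by (simp_all add: skew_product_def)

lemma local_homeo_functor_in_topspace:
  assumes "local_homeo_functor C X \<tau>" "l \<in> Mor C" "x \<in> topspace X"
  shows "\<tau> l x \<in> topspace X"
  using assms unfolding local_homeo_functor_def local_homeo_def by blast

lemma mem_composable_skew_product:
  assumes "local_homeo_functor C X \<tau>"
  shows "((l, y), (m, x)) \<in> composable (skew_product C X \<tau>) \<longleftrightarrow>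
           (l, m) \<in> composable C \<and> x \<in> topspace X \<and> y = \<tau> m x"
  using local_homeo_functor_in_topspace[OF assms]
  by (auto simp: composable_def)

lemma small_category_skew_product:
  assumes C: "small_category C" and \<tau>: "local_homeo_functor C X \<tau>"
  shows "small_category (skew_product C X \<tau>)"
proof -
  interpret small_category C by (fact C)
  note comp = mem_composable_skew_product[OF \<tau>]
  have \<tau>_idn: "\<tau> (idn C v) x = x" if "v \<in> Obj C" "x \<in> topspace X" for v x
    using \<tau> that unfolding local_homeo_functor_def by blast
  have \<tau>_cmp: "\<tau> (cmp C l m) x = \<tau> l (\<tau> m x)"
    if "(l, m) \<in> composable C" "x \<in> topspace X" for l m x
    using \<tau> that unfolding local_homeo_functor_def by blast
  note simps = rng_obj src_obj idn_mor rng_idn src_idn cmp_mor rng_cmp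
    src_cmp idn_cmp cmp_idn cmp_assoc \<tau>_idn \<tau>_cmp local_homeo_functor_in_topspace[OF \<tau>]
  show ?thesis
  proof (unfold_locales, goal_cases)
    case (6 l m) then show ?case by (cases l; cases m) (simp add: comp simps)
  next
    case (7 l m) then show ?case by (cases l; cases m) (simp add: comp simps)
  next
    case (8 l m) then show ?case by (cases l; cases m) (simp add: comp simps)
  next
    case (11 l m n)
    then show ?case by (cases l; cases m; cases n) (simp add: comp simps)
  qed (auto simp: simps)
qed

lemma degree_functor_skew_product:
  assumes d: "degree_functor k C d" and \<tau>: "local_homeo_functor C X \<tau>"
  shows "degree_functor k (skew_product C X \<tau>) (skew_degree d)"
proof -
  have "skew_degree d (cmp (skew_product C X \<tau>) p q) = skew_degree d p + skew_degree d q"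
    if "(p, q) \<in> composable (skew_product C X \<tau>)" for p q
    using that d
    by (cases p; cases q)
      (auto simp: mem_composable_skew_product[OF \<tau>] degree_functor_def skew_degree_def)
  then show ?thesis
    using d by (auto simp: degree_functor_def skew_degree_def)
qed

lemma unique_factorization_skew_product:
  assumes fact: "unique_factorization k C d" and \<tau>: "local_homeo_functor C X \<tau>"
  shows "unique_factorization k (skew_product C X \<tau>) (skew_degree d)"
  unfolding unique_factorization_def
proof (intro ballI impI)
  let ?S = "skew_product C X \<tau>"
  fix p m n
  assume p: "p \<in> Mor ?S" and mn: "m \<in> Nvec k" "n \<in> Nvec k" "skew_degree d p = m + n"
  obtain l x where lx: "p = (l, x)" "l \<in> Mor C" "x \<in> topspace X"
    using p by auto
  have "d l = m + n" using mn(3) lx(1) by (simp add: skew_degree_def)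
  with fact lx(2) mn
  have ex1: "\<exists>!(\<mu>, \<nu>). (\<mu>, \<nu>) \<in> composable C \<and> d \<mu> = m \<and> d \<nu> = n \<and> l = cmp C \<mu> \<nu>"
    unfolding unique_factorization_def by blast
  let ?P = "\<lambda>(\<mu>, \<nu>). (\<mu>, \<nu>) \<in> composable C \<and> d \<mu> = m \<and> d \<nu> = n \<and> l = cmp C \<mu> \<nu>"
  let ?Q = "\<lambda>(\<mu>, \<nu>). (\<mu>, \<nu>) \<in> composable ?S \<and> skew_degree d \<mu> = m \<and> skew_degree d \<nu> = n \<and>
    p = cmp ?S \<mu> \<nu>"
  have Q_iff: "?Q ((a, y), (b, z)) \<longleftrightarrow> ?P (a, b) \<and> z = x \<and> y = \<tau> b x" for a b y z
    using lx by (auto simp: mem_composable_skew_product[OF \<tau>] skew_degree_def)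
  obtain \<mu> \<nu> where P: "?P (\<mu>, \<nu>)" "\<And>q. ?P q \<Longrightarrow> q = (\<mu>, \<nu>)"
    using ex1 by (metis (no_types, lifting) surj_pair)
  show "\<exists>!q. ?Q q"
  proof (rule ex1I[of _ "((\<mu>, \<tau> \<nu> x), (\<nu>, x))"])
    show "?Q ((\<mu>, \<tau> \<nu> x), (\<nu>, x))" unfolding Q_iff using P(1) by simp
    fix q assume q: "?Q q"
    obtain a y b z where qq: "q = ((a, y), (b, z))" by (metis surj_pair)
    have "?P (a, b) \<and> z = x \<and> y = \<tau> b x" using q unfolding qq Q_iff .
    with P(2)[of "(a, b)"] show "q = ((\<mu>, \<tau> \<nu> x), (\<nu>, x))" unfolding qq by simp
  qed
qed

section \<open>Continuity and openness of composition\<close>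

context
  fixes C :: "('o, 'm) cat" and X :: "'x topology" and \<tau> :: "'m \<Rightarrow> 'x \<Rightarrow> 'x"
  assumes C: "small_category C" and \<tau>: "local_homeo_functor C X \<tau>"
begin

interpretation small_category C by (fact C)

abbreviation (input) "TMor \<equiv> prod_topology (discrete_topology (Mor C)) X"

abbreviation (input) "TComp \<equiv>
  subtopology (prod_topology TMor TMor) (composable (skew_product C X \<tau>))"

text \<open>Composition forgets the \<open>X\<close>-coordinate of the left factor. It is therefore a function of
  the discrete coordinates, which is continuous for free, paired with a projection to \<open>X\<close>.\<close>

lemma continuous_map_skew_cmp:
  "continuous_map TComp TMor (\<lambda>(p, q). cmp (skew_product C X \<tau>) p q)"
proof -
  let ?DD = "discrete_topology (Mor C \<times> Mor C)"
  have fst_snd: "continuous_map TComp TMor fst" "continuous_map TComp TMor snd"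
    by (auto intro!: continuous_map_from_subtopology continuous_map_fst continuous_map_snd)
  have "continuous_map TComp ?DD (\<lambda>(p, q). (fst p, fst q))"
    unfolding prod_topology_discrete_topology continuous_map_pairwise
    using fst_snd by (auto simp: continuous_map_pairwise comp_def case_prod_unfold)
  then have "continuous_map TComp (subtopology ?DD (composable C)) (\<lambda>(p, q). (fst p, fst q))"
    by (auto simp: continuous_map_in_subtopology mem_composable_skew_product[OF \<tau>]
        simp del: subtopology_discrete_topology)
  moreover have "continuous_map (subtopology ?DD (composable C)) (discrete_topology (Mor C))
      (\<lambda>(l, m). cmp C l m)"
    using cmp_mor by (auto simp: composable_def)
  ultimately have "continuous_map TComp (discrete_topology (Mor C))
      ((\<lambda>(l, m). cmp C l m) \<circ> (\<lambda>(p, q). (fst p, fst q)))"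
    by (rule continuous_map_compose)
  moreover have "cmp (skew_product C X \<tau>) p q = (cmp C (fst p) (fst q), snd q)" for p q
    by (cases p; cases q) simp
  ultimately show ?thesis
    using fst_snd(2) by (simp add: continuous_map_pairwise comp_def case_prod_unfold)
qed

text \<open>An open set of composable pairs need not be a union of product sets, since the left point is
  tied to the right one by \<open>y = \<tau> m x\<close>. The map \<open>?g\<close> below parametrizes the composable pairs over
  \<open>(l, m)\<close> by the right point alone, which is exactly the \<open>X\<close>-coordinate of the composite.\<close>

lemma open_map_skew_cmp:
  "open_map TComp TMor (\<lambda>(p, q). cmp (skew_product C X \<tau>) p q)"
  unfolding open_map_def
proof (intro allI impI)
  let ?F = "\<lambda>(p, q). cmp (skew_product C X \<tau>) p q"
  fix W assume "openin TComp W"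
  then obtain V where V: "openin (prod_topology TMor TMor) V"
    and W: "W = V \<inter> composable (skew_product C X \<tau>)"
    unfolding openin_subtopology by blast
  show "openin TMor (?F ` W)"
  proof (subst openin_subopen, intro ballI)
    fix r assume "r \<in> ?F ` W"
    then obtain l m x where w: "((l, \<tau> m x), (m, x)) \<in> V" "(l, m) \<in> composable C" "x \<in> topspace X"
      and r: "r = (cmp C l m, x)"
      unfolding W by (auto simp: mem_composable_skew_product[OF \<tau>])
    have lm: "l \<in> Mor C" "m \<in> Mor C" using w(2) by (auto simp: composable_def)
    let ?g = "\<lambda>x. ((l, \<tau> m x), (m, x))"
    let ?N = "{x \<in> topspace X. ?g x \<in> V}"
    have "continuous_map X X (\<tau> m)"
      using \<tau> lm(2) local_homeo_imp_continuous_map unfolding local_homeo_functor_def by blast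
    then have "continuous_map X (prod_topology TMor TMor) ?g"
      using lm by (auto simp: continuous_map_pairwise comp_def)
    from openin_continuous_map_preimage[OF this V] have "openin TMor ({cmp C l m} \<times> ?N)"
      using cmp_mor[OF w(2)] by (simp add: openin_prod_Times_iff)
    moreover have "{cmp C l m} \<times> ?N \<subseteq> ?F ` W"
    proof clarify
      fix z assume z: "z \<in> topspace X" "?g z \<in> V"
      then have "?g z \<in> W" unfolding W using w(2) by (simp add: mem_composable_skew_product[OF \<tau>])
      then show "(cmp C l m, z) \<in> ?F ` W"
        by (rule rev_image_eqI) simp
    qed
    ultimately show "\<exists>T. openin TMor T \<and> r \<in> T \<and> T \<subseteq> ?F ` W"
      using w r by (intro exI[of _ "{cmp C l m} \<times> ?N"]) auto
  qed
qed

end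

section \<open>The skew product as a topological k-graph\<close>

theorem proposition4p1:
  fixes k :: nat
    and \<Lambda> :: "('o, 'm) cat"
    and d :: "'m \<Rightarrow> nat \<Rightarrow> nat"
    and X :: "'x topology"
    and \<tau> :: "'m \<Rightarrow> 'x \<Rightarrow> 'x"
  assumes "k_graph k \<Lambda> d"
    and "finitely_aligned \<Lambda> d"
    and "no_sources k \<Lambda> d"
    and "second_countable X" "locally_compact_space X" "Hausdorff_space X"
    and "local_homeo_functor \<Lambda> X \<tau>"
  shows "topological_k_graph k (skew_product \<Lambda> X \<tau>)
           (prod_topology (discrete_topology (Obj \<Lambda>)) X)
           (prod_topology (discrete_topology (Mor \<Lambda>)) X)
           (skew_degree d)"
proof -
  interpret k_graph k \<Lambda> d by (fact assms(1))
  note C = small_category_axioms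
  note \<tau> = assms(7)
  let ?S = "skew_product \<Lambda> X \<tau>"
  let ?TO = "prod_topology (discrete_topology (Obj \<Lambda>)) X"
  let ?TM = "prod_topology (discrete_topology (Mor \<Lambda>)) X"
  have \<tau>_continuous: "continuous_map X X (\<tau> l)" if "l \<in> Mor \<Lambda>" for l
    using \<tau> that local_homeo_imp_continuous_map unfolding local_homeo_functor_def by blast
  have src: "src ?S = (\<lambda>(l, x). (src \<Lambda> l, x))" by auto
  have src_homeo: "local_homeo ?TM ?TO (src ?S)"
    unfolding src by (rule local_homeo_prod_discrete) (auto simp: src_obj)
  have rng: "continuous_map ?TM ?TO (rng ?S)"
    using \<tau>_continuous rng_obj
    by (intro continuous_map_prod_discrete)
      (auto intro!: continuous_map_Pair_discrete)
  have deg: "continuous_map ?TM (discrete_topology (Nvec k)) (skew_degree d)"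
    using degree
    by (intro continuous_map_prod_discrete) (auto simp: skew_degree_def degree_functor_def)
  show ?thesis
    by (intro topological_k_graph.intro topological_k_graph_axioms.intro
        small_category_skew_product C \<tau> degree_functor_skew_product degree
        unique_factorization_skew_product factorization
        continuous_map_skew_cmp open_map_skew_cmp src_homeo
        local_homeo_imp_continuous_map[OF src_homeo] rng deg second_countable_prod_topology assms)
      (simp_all add: second_countable_discrete_topology countable_obj countable_mor
        locally_compact_space_prod_topology locally_compact_space_discrete_topology
        Hausdorff_space_prod_topology assms)
qed

end
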